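(* If $G$ is a $2$-connected graph of order $n$, then \[ \operatorname{lct}(G)\leq \left\lceil\frac{n}{3}-\frac{n^{2/3}}{36}\right\rceil . \]
   Context: All graphs are simple, finite, and undirected; the order of a graph is its number of vertices. A longest cycle of a graph $G$ is a cycle in $G$ of maximum length among all cycles in $G$. A longest cycle transversal of $G$ is a set of vertices of $G$ that intersects the vertex set of every longest cycle of $G$. $\operatorname{lct}(G)$ denotes the minimum cardinality of a longest cycle transversal of $G$. As usual, a graph is $2$-connected if it has at least $3$ vertices, is connected, and remains connected after the deletion of any single vertex. *)

theory Defs
  imports Complex_Main "Graph_Theory.Graph_Theory"
begin

(* Finite simple undirected graphs are the library's locale graph: finite symmetric
   digraphs without loops and parallel arcs, where the edge uv is the pair of arcs
   from u to v and from v to u. *)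

definition two_connected :: "('a, 'b) pre_digraph \<Rightarrow> bool" where
  "two_connected G \<longleftrightarrow>
     3 \<le> card (verts G) \<and> connected G \<and>
     (\<forall>v \<in> verts G. connected (pre_digraph.del_vert G v))"

(* The digraph notion of cycle admits the closed walk u, v, u along a single edge.
   In a loop-free graph without parallel arcs, this is the only kind of cycle of length
   less than 3, so the length condition leaves exactly the cycles of the undirected
   graph. *)
definition ucycle :: "('a, 'b) pre_digraph \<Rightarrow> 'b awalk \<Rightarrow> bool" where
  "ucycle G p \<longleftrightarrow> pre_digraph.cycle G p \<and> 3 \<le> length p"

definition longest_cycle :: "('a, 'b) pre_digraph \<Rightarrow> 'b awalk \<Rightarrow> bool" where
  "longest_cycle G p \<longleftrightarrow> ucycle G p \<and> (\<forall>q. ucycle G q \<longrightarrow> length q \<le> length p)"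

(* On a closed walk every vertex is the tail of some arc. *)
definition cycle_verts :: "('a, 'b) pre_digraph \<Rightarrow> 'b awalk \<Rightarrow> 'a set" where
  "cycle_verts G p = tail G ` set p"

definition longest_cycle_transversal :: "('a, 'b) pre_digraph \<Rightarrow> 'a set \<Rightarrow> bool" where
  "longest_cycle_transversal G S \<longleftrightarrow>
     S \<subseteq> verts G \<and> (\<forall>p. longest_cycle G p \<longrightarrow> S \<inter> cycle_verts G p \<noteq> {})"

definition lct :: "('a, 'b) pre_digraph \<Rightarrow> nat" where
  "lct G = (LEAST k. \<exists>S. longest_cycle_transversal G S \<and> card S = k)"

lemma cycle_verts_eq:
  assumes "pre_digraph.awalk G u p u" "p \<noteq> []"
  shows "cycle_verts G p = set (pre_digraph.awalk_verts G u p)"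
proof -
  have "set (pre_digraph.awalk_verts G v p) = insert w (tail G ` set p)"
    if "pre_digraph.cas G v p w" for v w
    using that
    by (induction p arbitrary: v)
       (auto simp: pre_digraph.awalk_verts.simps pre_digraph.cas.simps)
  moreover have "pre_digraph.cas G u p u"
    using assms(1) by (simp add: pre_digraph.awalk_def)
  moreover have "u \<in> tail G ` set p"
    using assms(2) \<open>pre_digraph.cas G u p u\<close>
    by (cases p) (auto simp: pre_digraph.cas.simps)
  ultimately show ?thesis
    by (auto simp: cycle_verts_def)
qed

lemma (in wf_digraph) longest_cycle_transversal_verts:
  "longest_cycle_transversal G (verts G)"
proof -
  have "verts G \<inter> cycle_verts G p \<noteq> {}" if "cycle p" for p
    using that by (cases p) (auto simp: cycle_def awalk_def cycle_verts_def)
  then show ?thesis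
    by (auto simp: longest_cycle_transversal_def longest_cycle_def ucycle_def)
qed

lemma (in wf_digraph) lct_attained:
  "\<exists>S. longest_cycle_transversal G S \<and> card S = lct G"
  unfolding lct_def
  by (rule LeastI[where P = "\<lambda>k. \<exists>S. longest_cycle_transversal G S \<and> card S = k"])
     (use longest_cycle_transversal_verts in blast)

lemma lct_le: "longest_cycle_transversal G S \<Longrightarrow> lct G \<le> card S"
  unfolding lct_def by (rule Least_le) blast

end

theory Submission
  imports Defs
begin

text \<open>
  The bound holds because a transversal with at most \<open>\<lceil>n/4\<rceil>\<close> vertices exists; this is at most
  \<open>\<lceil>n/3 - n\<^sup>2\<^sup>/\<^sup>3/36\<rceil>\<close>, since \<open>n\<^sup>2\<^sup>/\<^sup>3 \<le> n\<close> and \<open>1/3 - 1/36 \<ge> 1/4\<close>.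

  Let \<open>lct G \<ge> 2\<close> and put \<open>a = lct G - 1\<close>. Every set of at most \<open>a\<close> vertices
  is avoided by some longest cycle, and this freedom is used twice. For a longest cycle \<open>C\<close> and a component \<open>W\<close> of \<open>G - C\<close>, let \<open>N\<close> be the set of
  neighbours of \<open>W\<close>; it lies on \<open>C\<close>. Choose \<open>C\<close> and \<open>W\<close> such that \<open>W\<close> is as large as possible.

  First, \<open>N\<close> has at least \<open>a + 1\<close> vertices. Otherwise some longest cycle \<open>D\<close> avoids \<open>N\<close>. It cannot lie
  in \<open>W\<close>, because two longest cycles of a 2-connected graph share a vertex (\<open>longest_cycles_meet\<close>). So
  it misses \<open>W\<close>, and \<open>W \<union> N\<close> lies in one component of \<open>G - D\<close>, against the choice of \<open>W\<close>.

  Second, let \<open>T\<close> be the set of successors of the vertices of \<open>N\<close> on \<open>C\<close>, and \<open>Z = C - T\<close>. Rerouting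
  \<open>C\<close> through \<open>W\<close> shows that \<open>T\<close> is disjoint from \<open>N\<close> and that no path with interior outside \<open>C\<close> joins
  two vertices of \<open>T\<close> (\<open>no_path_between_successors\<close>). Hence any cycle meets \<open>Z\<close> between any two of its
  visits to \<open>T\<close>. Now \<open>Z\<close> contains \<open>N\<close>, so there are \<open>a\<close> vertices in \<open>Z\<close>, and a longest cycle \<open>E\<close> avoids
  them. With \<open>\<ell> = |C| = |E|\<close> and \<open>q = |N| = |T|\<close>, the cycle \<open>E\<close> has at most \<open>\<ell> - q - a\<close> vertices in \<open>Z\<close>,
  at most one more than that in \<open>T\<close>, and at most \<open>n - \<ell>\<close> elsewhere. Therefore
  \<open>\<ell> \<le> 2(\<ell> - q - a) + 1 + (n - \<ell>)\<close>, that is, \<open>2q + 2a \<le> n + 1\<close>, and \<open>q \<ge> a + 1\<close> gives \<open>4a < n\<close>.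
\<close>

section \<open>Lists\<close>

text \<open>
  Membership in a component does not change along a step of a walk, so the walk stays inside it or
  outside it.
\<close>

lemma successively_const:
  assumes "successively R p" "\<And>u v. u \<in> set p \<Longrightarrow> v \<in> set p \<Longrightarrow> R u v \<Longrightarrow> P u \<longleftrightarrow> P v"
    and "x \<in> set p" "y \<in> set p"
  shows "P x \<longleftrightarrow> P y"
proof -
  have "\<forall>y \<in> set p. P y \<longleftrightarrow> P (hd p)"
    using assms(1,2)
  proof (induction p)
    case (Cons a p)
    show ?case
    proof (cases "p = []")
      case False
      then have "P a \<longleftrightarrow> P (hd p)"
        using Cons.prems by (auto simp: successively_Cons)
      moreover have "\<forall>y \<in> set p. P y \<longleftrightarrow> P (hd p)"
        using Cons by (auto simp: successively_Cons)
      ultimately show ?thesis by auto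
    qed simp
  qed simp
  then show ?thesis using assms(3,4) by blast
qed

lemma rtranclp_distinct_list:
  assumes "R\<^sup>*\<^sup>* x y"
  shows "\<exists>p. p \<noteq> [] \<and> distinct p \<and> successively R p \<and> hd p = x \<and> last p = y"
  using assms
proof (induction rule: rtranclp_induct)
  case base
  show ?case by (rule exI[of _ "[x]"]) simp
next
  case (step y z)
  then obtain p where p: "p \<noteq> []" "distinct p" "successively R p" "hd p = x" "last p = y"
    by blast
  show ?case
  proof (cases "z \<in> set p")
    case True
    then obtain as bs where "p = as @ z # bs" by (meson split_list)
    with p show ?thesis
      by (intro exI[of _ "as @ [z]"]) (auto simp: successively_append_iff hd_append)
  next
    case False
    with p step.hyps show ?thesis
      by (intro exI[of _ "p @ [z]"]) (auto simp: successively_append_iff)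
  qed
qed

text \<open>
  Between consecutive visits to \<open>T\<close> the list visits \<open>Z\<close>, which gives \<open>Z\<close> all but one of the visits that
  \<open>T\<close> has. Read cyclically the extra \<open>1\<close> would disappear, but it does no harm in the final count.
\<close>

lemma card_le_if_separated:
  assumes "distinct xs" "T \<inter> Z = {}"
    and sep: "\<And>as t bs t' cs. xs = as @ t # bs @ t' # cs \<Longrightarrow> t \<in> T \<Longrightarrow> t' \<in> T \<Longrightarrow> set bs \<inter> Z \<noteq> {}"
  shows "card (set xs \<inter> T) \<le> card (set xs \<inter> Z) + 1"
  using assms(1) sep
proof (induction xs rule: length_induct)
  case (1 xs)
  show ?case
  proof (cases "\<exists>t \<in> set xs. t \<in> T")
    case True
    then obtain as t ys where xs: "xs = as @ t # ys" and t: "t \<in> T" and as: "\<forall>u \<in> set as. u \<notin> T"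
      using split_list_first_prop[OF True] by blast
    have tZ: "t \<notin> Z" using t assms(2) by auto
    show ?thesis
    proof (cases "\<exists>t \<in> set ys. t \<in> T")
      case True
      then obtain bs t' cs where ys: "ys = bs @ t' # cs" and t': "t' \<in> T" and bs: "\<forall>u \<in> set bs. u \<notin> T"
        using split_list_first_prop[OF True] by blast
      have IH: "card (set (t' # cs) \<inter> T) \<le> card (set (t' # cs) \<inter> Z) + 1"
      proof -
        have "set bs' \<inter> Z \<noteq> {}" if "t' # cs = as' @ u # bs' @ u' # cs'" "u \<in> T" "u' \<in> T" for as' u bs' u' cs'
          using 1(3)[of "as @ t # bs @ as'" u bs' u' cs'] that xs ys by simp
        then show ?thesis
          using 1(1)[rule_format, of "t' # cs"] 1(2) xs ys by auto
      qed
      obtain z where z: "z \<in> set bs" "z \<in> Z"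
        using 1(3)[of as t bs t' cs] xs ys t t' by auto
      have "set xs \<inter> T = insert t (set (t' # cs) \<inter> T)"
        using xs ys as bs t by auto
      then have "card (set xs \<inter> T) \<le> Suc (card (set (t' # cs) \<inter> T))"
        by (simp add: card_insert_if)
      also have "\<dots> \<le> Suc (card (set (t' # cs) \<inter> Z)) + 1"
        using IH by simp
      also have "Suc (card (set (t' # cs) \<inter> Z)) = card (insert z (set (t' # cs) \<inter> Z))"
        using z 1(2) xs ys by (intro card_insert_disjoint[symmetric]) auto
      also have "\<dots> \<le> card (set xs \<inter> Z)"
        using z xs ys by (intro card_mono) auto
      finally show ?thesis by simp
    next
      case False
      then have "set xs \<inter> T = {t}" using xs as t by auto
      then show ?thesis by simp
    qed
  next
    case False
    then have "set xs \<inter> T = {}" by auto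
    then show ?thesis by simp
  qed
qed

section \<open>Paths, cycles and components\<close>

text \<open>
  With cycles as lists of vertices, the surgery on cycles becomes plain list manipulation; arcs and walks
  of arcs would only add a choice of arc for every step.
\<close>

locale vertex_graph =
  fixes V :: "'a set" and adj :: "'a \<Rightarrow> 'a \<Rightarrow> bool"
  assumes finite_V: "finite V"
    and adj_sym: "adj x y \<Longrightarrow> adj y x"
    and adj_irrefl: "\<not> adj x x"
    and adj_in_V: "adj x y \<Longrightarrow> x \<in> V"
begin

definition path :: "'a list \<Rightarrow> bool" where
  "path p \<longleftrightarrow> p \<noteq> [] \<and> distinct p \<and> successively adj p"

definition cyc :: "'a list \<Rightarrow> bool" where
  "cyc c \<longleftrightarrow> 3 \<le> length c \<and> distinct c \<and> successively adj c \<and> adj (last c) (hd c)"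

definition longest :: "'a list \<Rightarrow> bool" where
  "longest c \<longleftrightarrow> cyc c \<and> (\<forall>d. cyc d \<longrightarrow> length d \<le> length c)"

definition conn :: "'a set \<Rightarrow> 'a \<Rightarrow> 'a \<Rightarrow> bool" where
  "conn S = (\<lambda>u v. adj u v \<and> u \<notin> S \<and> v \<notin> S)\<^sup>*\<^sup>*"

definition component :: "'a set \<Rightarrow> 'a \<Rightarrow> 'a set" where
  "component S x = {y. conn S x y}"

definition nbhd :: "'a set \<Rightarrow> 'a set" where
  "nbhd W = {v. v \<notin> W \<and> (\<exists>w \<in> W. adj v w)}"

lemma adj_commute: "adj x y \<longleftrightarrow> adj y x"
  using adj_sym by blast

lemma successively_adj_flip [simp]: "successively (\<lambda>x y. adj y x) p \<longleftrightarrow> successively adj p"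
proof -
  have "(\<lambda>x y. adj y x) = adj" using adj_commute by blast
  then show ?thesis by (rule arg_cong)
qed

lemma path_rev [simp]: "path (rev p) \<longleftrightarrow> path p"
  by (simp add: path_def)

lemma path_appendD1: "path (p @ q) \<Longrightarrow> p \<noteq> [] \<Longrightarrow> path p"
  and path_appendD2: "path (p @ q) \<Longrightarrow> q \<noteq> [] \<Longrightarrow> path q"
  by (auto simp: path_def successively_append_iff)

lemma cyc_subset_V: "cyc c \<Longrightarrow> set c \<subseteq> V"
proof
  fix x assume c: "cyc c" and "x \<in> set c"
  then obtain as bs where "c = as @ x # bs" by (meson split_list)
  with c show "x \<in> V"
    using adj_in_V adj_sym
    by (cases bs) (auto simp: cyc_def successively_append_iff)
qed

lemma cyc_append_commute: "cyc (p @ q) \<Longrightarrow> cyc (q @ p)"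
  by (cases "p = []"; cases "q = []") (auto simp: cyc_def successively_append_iff)

lemma cyc_rotate: "cyc c \<Longrightarrow> cyc (rotate k c)"
  using cyc_append_commute[of "take (k mod length c) c" "drop (k mod length c) c"]
  by (simp add: rotate_drop_take)

lemma conn_sym: "conn S x y \<Longrightarrow> conn S y x"
  unfolding conn_def
  by (rule sympD[OF symp_rtranclp]) (auto intro: sympI adj_sym)

lemma conn_trans: "conn S x y \<Longrightarrow> conn S y z \<Longrightarrow> conn S x z"
  unfolding conn_def by (rule rtranclp_trans)

lemma conn_adj: "adj x y \<Longrightarrow> x \<notin> S \<Longrightarrow> y \<notin> S \<Longrightarrow> conn S x y"
  unfolding conn_def by auto

lemma conn_notin: "conn S x y \<Longrightarrow> x \<notin> S \<Longrightarrow> y \<notin> S"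
  unfolding conn_def by (induction rule: rtranclp_induct) auto

lemma conn_in_V: "conn S x y \<Longrightarrow> x \<in> V \<Longrightarrow> y \<in> V"
  unfolding conn_def by (induction rule: rtranclp_induct) (auto intro: adj_in_V adj_sym)

lemma conn_path:
  assumes "conn S x y" "x \<notin> S"
  shows "\<exists>p. path p \<and> hd p = x \<and> last p = y \<and> set p \<inter> S = {}"
proof -
  obtain p where p: "p \<noteq> []" "distinct p"
      "successively (\<lambda>u v. adj u v \<and> u \<notin> S \<and> v \<notin> S) p" "hd p = x" "last p = y"
    using rtranclp_distinct_list[OF assms(1)[unfolded conn_def]] by blast
  have "u \<notin> S" if "u \<in> set p" for u
    using successively_const[OF p(3), where P = "\<lambda>u. u \<notin> S" and x = u and y = x] that p(1,4) assms(2)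
      hd_in_set[OF p(1)] by blast
  moreover have "successively adj p"
    using p(3) by (rule successively_mono) simp
  ultimately show ?thesis
    using p by (intro exI[of _ p]) (auto simp: path_def)
qed

lemma component_closed:
  assumes "adj u v" "u \<notin> S" "v \<notin> S"
  shows "u \<in> component S x \<longleftrightarrow> v \<in> component S x"
  using conn_adj[OF assms] conn_sym conn_trans unfolding component_def mem_Collect_eq by metis

lemma component_path:
  assumes "w \<in> component S x" "w' \<in> component S x" "x \<notin> S"
  shows "\<exists>p. path p \<and> hd p = w \<and> last p = w' \<and> set p \<subseteq> component S x"
proof -
  have "conn S w w'" "w \<notin> S"
    using assms conn_sym conn_trans conn_notin unfolding component_def by blast+
  then obtain p where p: "path p" "hd p = w" "last p = w'" "set p \<inter> S = {}"
    using conn_path by blast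
  have s: "successively adj p" "w \<in> set p" using p hd_in_set by (auto simp: path_def)
  have "u \<in> component S x" if "u \<in> set p" for u
    using successively_const[OF s(1), where P = "\<lambda>u. u \<in> component S x" and x = u and y = w]
      that s(2) p(4) assms(1) component_closed by blast
  then show ?thesis using p by blast
qed

lemma nbhd_component_subset: "x \<notin> S \<Longrightarrow> nbhd (component S x) \<subseteq> S"
proof
  fix v assume x: "x \<notin> S" and "v \<in> nbhd (component S x)"
  then obtain w where w: "v \<notin> component S x" "w \<in> component S x" "adj v w"
    by (auto simp: nbhd_def)
  then have "w \<notin> S" using x conn_notin by (auto simp: component_def)
  then show "v \<in> S" using w component_closed[of v w S x] by blast
qed

section \<open>Enlarging a cycle\<close>

lemma cyc_append_path:
  assumes "cyc c" "path p" "set p \<inter> set c = {}" "adj (last c) (hd p)" "adj (last p) (hd c)"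
  shows "cyc (c @ p)"
  using assms by (auto simp: cyc_def path_def successively_append_iff hd_append)

text \<open>
  Cut a cycle into two arcs \<open>as\<close> and \<open>bs\<close>. If one detour joins their first vertices and another one
  joins their last vertices, then reversing \<open>as\<close> gives a cycle through both arcs and both detours.
  The detour \<open>q\<close> may be empty; \<open>p\<close> is not, so the new cycle is strictly longer than the old one.
\<close>

lemma cyc_crossing:
  assumes "cyc (as @ bs)" "as \<noteq> []" "bs \<noteq> []"
    and q: "path ([hd as] @ q @ [hd bs])" "set q \<inter> set (as @ bs) = {}"
    and p: "path p" "adj (last bs) (hd p)" "adj (last p) (last as)" "set p \<inter> set (as @ bs @ q) = {}"
  shows "cyc (rev as @ q @ bs @ p)"
proof -
  have ab: "distinct as" "distinct bs" "set as \<inter> set bs = {}" "successively adj as" "successively adj bs"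
      "3 \<le> length as + length bs"
    using assms(1) by (auto simp: cyc_def successively_append_iff)
  have p': "p \<noteq> []" "distinct p" "successively adj p"
    using p(1) by (auto simp: path_def)
  have q': "successively adj (hd as # q @ bs)" "distinct q"
    using q(1) ab(5) assms(3) by (auto simp: path_def successively_append_iff successively_Cons hd_append)
  have "successively adj ((q @ bs) @ p)"
    using q'(1) p' p(2) assms(3) by (auto simp: successively_append_iff successively_Cons)
  then have "successively adj (rev as @ q @ bs @ p)"
    using q'(1) ab(4) assms(2,3)
    by (subst successively_append_iff) (auto simp: successively_Cons last_rev hd_append split: if_splits)
  moreover have "adj (last (rev as @ q @ bs @ p)) (hd (rev as @ q @ bs @ p))"
    using p' p(3) assms(2) by (simp add: hd_rev hd_append)
  moreover have "distinct (rev as @ q @ bs @ p)"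
    using ab p' q'(2) q(2) p(4) by auto
  moreover have "3 \<le> length (rev as @ q @ bs @ p)"
    using ab(6) by simp
  ultimately show ?thesis unfolding cyc_def by blast
qed

text \<open>
  The two arcs of a cycle between two of its vertices share exactly their ends, so together they have
  \<open>length c + 2\<close> vertices and the longer one has at least half of these.
\<close>

lemma cyc_long_arc:
  assumes "cyc c" "x \<in> set c" "y \<in> set c" "x \<noteq> y"
  shows "\<exists>p. path p \<and> hd p = x \<and> last p = y \<and> set p \<subseteq> set c \<and> length c + 2 \<le> 2 * length p"
proof -
  obtain s t where c: "c = s @ x # t" using assms(2) by (meson split_list)
  have cyc: "cyc (x # t @ s)" using assms(1) cyc_append_commute[of s "x # t"] c by simp
  obtain as bs where ts: "t @ s = as @ y # bs"
    using assms(3,4) c by (metis Un_iff set_append set_ConsD split_list)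
  have len: "length c = length as + length bs + 2"
    using arg_cong[OF ts, of length] c by simp
  have set: "set c = {x, y} \<union> set as \<union> set bs"
    using arg_cong[OF ts, of set] c by auto
  show ?thesis
  proof (cases "length bs \<le> length as")
    case True
    have "path (x # as @ [y])"
      using cyc unfolding ts
      by (auto simp: path_def cyc_def successively_append_iff successively_Cons hd_append split: if_splits)
    then show ?thesis
      using True len set
      by (intro exI[of _ "x # as @ [y]"]) auto
  next
    case False
    have "path (x # rev (y # bs))"
      using cyc adj_sym[of "last (y # bs)" x] adj_sym[of y "hd bs"] unfolding ts
      by (auto simp: path_def cyc_def successively_append_iff successively_Cons hd_rev last_rev
          split: if_splits)
    then show ?thesis
      using False len set
      by (intro exI[of _ "x # rev (y # bs)"]) auto
  qed
qed

text \<open>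
  A path may consist of a single vertex, so the ends of an edge inside \<open>D\<close> are linked to \<open>D\<close>.
\<close>

definition linked :: "'a set \<Rightarrow> 'a \<Rightarrow> 'a \<Rightarrow> bool" where
  "linked D x y \<longleftrightarrow>
     (\<exists>p q. path p \<and> path q \<and> hd p = x \<and> hd q = y \<and> last p \<in> D \<and> last q \<in> D \<and> set p \<inter> set q = {})"

lemma path_join:
  "path (p @ [v]) \<Longrightarrow> path (v # q) \<Longrightarrow> set p \<inter> set q = {} \<Longrightarrow> path (p @ v # q)"
  by (auto simp: path_def successively_append_iff)

text \<open>
  The part of the path from its last vertex in \<open>C\<close> to the first vertex of \<open>D\<close> after that one has its
  interior outside both sets.
\<close>

lemma path_between_sets:
  assumes "path p" "hd p \<in> C" "last p \<in> D" "C \<inter> D = {}"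
  obtains u m v where "path (u # m @ [v])" "u \<in> C" "v \<in> D" "set m \<inter> (C \<union> D) = {}"
    "set (u # m @ [v]) \<subseteq> set p"
proof -
  have "p \<noteq> []" using assms(1) by (simp add: path_def)
  then have "\<exists>u \<in> set p. u \<in> C" using assms(2) hd_in_set by blast
  then obtain p1 u p2 where p: "p = p1 @ u # p2" and u: "u \<in> C" and p2: "\<forall>w \<in> set p2. w \<notin> C"
    using split_list_last_prop[of p "\<lambda>u. u \<in> C"] by blast
  have "p2 \<noteq> []" using p u assms(3,4) by auto
  then have "\<exists>v \<in> set p2. v \<in> D" using assms(3) p last_in_set[of p2] by auto
  then obtain m v p3 where p2': "p2 = m @ v # p3" and v: "v \<in> D" and m: "\<forall>w \<in> set m. w \<notin> D"
    using split_list_first_prop[of p2 "\<lambda>v. v \<in> D"] by blast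
  have "path ((p1 @ (u # m @ [v])) @ p3)" using assms(1) p p2' by simp
  then have "path (u # m @ [v])" using path_appendD1 path_appendD2 by blast
  moreover have "set m \<inter> (C \<union> D) = {}" using m p2 p2' by auto
  moreover have "set (u # m @ [v]) \<subseteq> set p" using p p2' by auto
  ultimately show ?thesis using that u v by blast
qed

lemma cyc_two_paths:
  assumes r: "path r" "hd r = u" "last r = u'"
    and s: "path s" "hd s = v" "last s = v'"
    and m: "path (u # m @ [v])" and m': "path (u' # m' @ [v'])"
    and "set r \<inter> set s = {}" "set m \<inter> (set r \<union> set s) = {}" "set m' \<inter> (set r \<union> set s) = {}"
      "set m \<inter> set m' = {}" "3 \<le> length r + length s"
  shows "cyc (r @ m' @ rev s @ rev m)"
proof -
  have ne: "r \<noteq> []" "s \<noteq> []" using r s by (auto simp: path_def)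
  have "successively adj (m' @ rev s)"
    using m' s ne by (auto simp: path_def successively_append_iff successively_Cons hd_rev split: if_splits)
  moreover have "adj u' (hd (m' @ rev s))"
    using m' s ne by (auto simp: path_def successively_append_iff successively_Cons hd_rev hd_append split: if_splits)
  ultimately have "successively adj (r @ m' @ rev s)"
    using r ne by (auto simp: path_def successively_append_iff)
  moreover have m_rev: "path (v # rev m @ [u])"
    using m path_rev[of "u # m @ [v]"] by simp
  then have "successively adj (rev m)" "m \<noteq> [] \<longrightarrow> adj v (hd (rev m))"
    by (auto simp: path_def successively_append_iff successively_Cons hd_append)
  ultimately have "successively adj ((r @ m' @ rev s) @ rev m)"
    using s ne by (subst successively_append_iff) (auto simp: last_rev)
  moreover have "adj (last (v # rev m)) u"
    using m_rev by (auto simp: path_def successively_append_iff successively_Cons split: if_splits)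
  then have "adj (last (r @ m' @ rev s @ rev m)) (hd (r @ m' @ rev s @ rev m))"
    using r s ne by (auto simp: last_rev last_append split: if_splits)
  moreover have "distinct (r @ m' @ rev s @ rev m)"
    using assms by (auto simp: path_def)
  ultimately show ?thesis using assms(13) by (simp add: cyc_def)
qed

section \<open>Successors of the neighbours of a component\<close>

definition successors :: "'a list \<Rightarrow> 'a set \<Rightarrow> 'a set" where
  "successors c N = (\<lambda>i. c ! (Suc i mod length c)) ` {i. i < length c \<and> c ! i \<in> N}"

lemma successors_subset: "c \<noteq> [] \<Longrightarrow> successors c N \<subseteq> set c"
  by (auto simp: successors_def)

lemma card_successors:
  assumes "distinct c" "N \<subseteq> set c"
  shows "card (successors c N) = card N"
proof -
  let ?I = "{i. i < length c \<and> c ! i \<in> N}"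
  have "inj_on (\<lambda>i. c ! (Suc i mod length c)) ?I"
  proof (rule inj_onI)
    fix i j assume i: "i \<in> ?I" and j: "j \<in> ?I" and eq: "c ! (Suc i mod length c) = c ! (Suc j mod length c)"
    have "Suc i mod length c < length c" "Suc j mod length c < length c"
      using i by (auto intro!: mod_less_divisor)
    then have "Suc i mod length c = Suc j mod length c"
      using eq assms(1) nth_eq_iff_index_eq by blast
    then show "i = j" using i j by (auto simp: mod_Suc split: if_splits)
  qed
  then have "card (successors c N) = card ?I"
    unfolding successors_def by (rule card_image)
  also have "\<dots> = card ((!) c ` ?I)"
    using assms(1) by (intro card_image[symmetric]) (auto simp: inj_on_def nth_eq_iff_index_eq)
  also have "(!) c ` ?I = N"
    using assms(2) by (auto simp: in_set_conv_nth subset_iff image_iff)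
  finally show ?thesis .
qed

lemma nbhd_component_path:
  assumes "x \<notin> S" "u \<in> nbhd (component S x)" "v \<in> nbhd (component S x)"
  obtains p where "path p" "set p \<subseteq> component S x" "set p \<inter> S = {}" "adj u (hd p)" "adj (last p) v"
proof -
  obtain w w' where w: "w \<in> component S x" "adj u w" "w' \<in> component S x" "adj v w'"
    using assms by (auto simp: nbhd_def)
  then obtain p where "path p" "hd p = w" "last p = w'" "set p \<subseteq> component S x"
    using component_path assms(1) by blast
  moreover have "component S x \<inter> S = {}"
    using assms(1) conn_notin by (auto simp: component_def)
  ultimately show ?thesis using w adj_sym that by blast
qed

lemma longest_cyc: "longest c \<Longrightarrow> cyc c"
  by (simp add: longest_def)

lemma longest_not_longer: "longest c \<Longrightarrow> cyc d \<Longrightarrow> length d \<le> length c"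
  by (simp add: longest_def)

text \<open>
  If two neighbours of a component \<open>W\<close> of the rest of the graph were consecutive on a longest cycle, then
  a detour through \<open>W\<close> between them would give a longer cycle.
\<close>

lemma successors_disjoint:
  assumes c: "longest c" and x: "x \<notin> set c"
  defines "N \<equiv> nbhd (component (set c) x)"
  shows "successors c N \<inter> N = {}"
proof (rule ccontr)
  assume "successors c N \<inter> N \<noteq> {}"
  then obtain i where i: "i < length c" "c ! i \<in> N" "c ! (Suc i mod length c) \<in> N"
    by (auto simp: successors_def)
  define d where "d = rotate (Suc i) c"
  have ne: "c \<noteq> []" using i by auto
  have d: "cyc d" "set d = set c" "length d = length c"
    using cyc_rotate[OF longest_cyc[OF c], of "Suc i"] unfolding d_def by simp_all
  have hd: "hd d = c ! (Suc i mod length c)"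
    unfolding d_def using ne by (rule hd_rotate_conv_nth)
  have "last d = d ! (length c - 1)"
    using d(3) ne by (subst last_conv_nth) (auto simp: d_def)
  also have "\<dots> = c ! ((Suc i + (length c - 1)) mod length c)"
    unfolding d_def using ne by (subst nth_rotate) auto
  also have "(Suc i + (length c - 1)) mod length c = i"
  proof -
    have "Suc i + (length c - 1) = i + length c" using i(1) by simp
    then show ?thesis using i(1) by simp
  qed
  finally have last: "last d = c ! i" .
  obtain p where p: "path p" "set p \<inter> set c = {}" "adj (c ! i) (hd p)" "adj (last p) (c ! (Suc i mod length c))"
    using nbhd_component_path[OF x] i unfolding N_def by metis
  have "cyc (d @ p)"
    using cyc_append_path[OF d(1) p(1)] p d hd last by simp
  then have "length p = 0"
    using longest_not_longer[OF c] d(3) by fastforce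
  then show False using p by (simp add: path_def)
qed

text \<open>
  Let \<open>t\<close> and \<open>t'\<close> be the successors of \<open>u\<close> and \<open>u'\<close>. The two vertices \<open>u\<close> and \<open>u'\<close> are joined by a path in the
  component \<open>W\<close>. If \<open>t\<close> and \<open>t'\<close> were joined off the cycle as well, that second path would avoid \<open>W\<close>,
  because no successor has a neighbour in \<open>W\<close>, and crossing over along both paths would give a longer
  cycle.
\<close>

lemma no_path_between_successors:
  assumes c: "longest c" and x: "x \<notin> set c"
  defines "N \<equiv> nbhd (component (set c) x)"
  assumes t: "t \<in> successors c N" "t' \<in> successors c N" "t \<noteq> t'"
    and q: "path ([t] @ q @ [t'])" "set q \<inter> set c = {}"
  shows False
proof -
  have *: False
    if ij: "i < j" "j < length c" "c ! i \<in> N" "c ! j \<in> N"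
      and q: "path ([c ! (Suc i mod length c)] @ q @ [c ! (Suc j mod length c)])" "set q \<inter> set c = {}"
    for i j q
  proof -
    define as where "as = drop (Suc i) (take (Suc j) c)"
    define bs where "bs = drop (Suc j) c @ take (Suc i) c"
    have c_eq: "c = take (Suc i) c @ as @ drop (Suc j) c"
    proof -
      have "take (Suc j) c = take (Suc i) (take (Suc j) c) @ as"
        unfolding as_def by (rule append_take_drop_id[symmetric])
      also have "take (Suc i) (take (Suc j) c) = take (Suc i) c"
        using ij by (simp add: min_def)
      finally show ?thesis by (metis append_take_drop_id append.assoc)
    qed
    have cyc: "cyc (as @ bs)"
      using cyc_append_commute[of "take (Suc i) c" "as @ drop (Suc j) c"] longest_cyc[OF c] c_eq
      unfolding bs_def by simp
    have ne: "as \<noteq> []" "bs \<noteq> []" using ij unfolding as_def bs_def by auto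
    have hd_as: "hd as = c ! (Suc i mod length c)"
      using ij unfolding as_def by (simp add: hd_drop_conv_nth)
    have last_as: "last as = c ! j"
      using ij ne unfolding as_def by (simp add: last_conv_nth)
    have last_bs: "last bs = c ! i"
    proof -
      have "last (take (Suc i) c) = c ! i"
        using ij by (subst take_Suc_conv_app_nth) auto
      then show ?thesis using ij unfolding bs_def by (auto simp: last_append)
    qed
    have hd_bs: "hd bs = c ! (Suc j mod length c)"
    proof (cases "Suc j = length c")
      case True
      then show ?thesis using ij unfolding bs_def by (cases c) auto
    next
      case False
      then show ?thesis using ij unfolding bs_def by (simp add: hd_drop_conv_nth hd_append)
    qed
    have set: "set (as @ bs) = set c"
      using arg_cong[OF c_eq, of set] unfolding bs_def by auto
    have len: "length (as @ bs) = length c"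
      using arg_cong[OF c_eq, of length] unfolding bs_def by simp
    obtain p where p: "path p" "set p \<subseteq> component (set c) x" "set p \<inter> set c = {}"
        "adj (c ! i) (hd p)" "adj (last p) (c ! j)"
      using nbhd_component_path[OF x] ij unfolding N_def by metis
    \<comment> \<open>an empty \<open>q\<close> stands for an edge between the two successors\<close>
    have "set q \<inter> component (set c) x = {}"
    proof (cases "q = []")
      case False
      let ?t = "c ! (Suc i mod length c)"
      have "?t \<in> successors c N" using ij unfolding successors_def by (intro imageI) simp
      then have "?t \<notin> N" using successors_disjoint[OF c x] unfolding N_def by auto
      moreover have "?t \<in> set c" using ij by (auto intro: nth_mem mod_less_divisor)
      then have "?t \<notin> component (set c) x"
        using x conn_notin by (auto simp: component_def)
      moreover have "adj ?t (hd q)" and succ: "successively adj q"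
        using q False by (auto simp: path_def successively_append_iff successively_Cons hd_append)
      ultimately have "hd q \<notin> component (set c) x"
        by (auto simp: N_def nbhd_def)
      then show ?thesis
        using successively_const[OF succ, where P = "\<lambda>u. u \<in> component (set c) x" and y = "hd q"]
          q(2) component_closed hd_in_set[OF False] by blast
    qed simp
    then have "set p \<inter> set (as @ bs @ q) = {}"
      using p set by auto
    then have "cyc (rev as @ q @ bs @ p)"
      using cyc_crossing[OF cyc ne, of q p] q p set hd_as last_as last_bs hd_bs by simp
    then have "length (rev as @ q @ bs @ p) \<le> length (as @ bs)"
      using longest_not_longer[OF c, of "rev as @ q @ bs @ p"] len by simp
    then show False using p(1) by (simp add: path_def)
  qed
  obtain i j where ij: "i < length c" "j < length c" "c ! i \<in> N" "c ! j \<in> N"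
      "t = c ! (Suc i mod length c)" "t' = c ! (Suc j mod length c)"
    using t(1,2) by (auto simp: successors_def)
  have q': "path ([t'] @ rev q @ [t])"
    using q(1) path_rev[of "[t] @ q @ [t']"] by simp
  \<comment> \<open>the two successors play symmetric roles, so the walk may be reversed\<close>
  consider "i < j" | "j < i" using ij t(3) by fastforce
  then show False
  proof cases
    case 1
    then show ?thesis using *[of i j q] ij q by simp
  next
    case 2
    then show ?thesis using *[of j i "rev q"] ij q q' by simp
  qed
qed

end

section \<open>Longest cycles of a 2-connected graph meet\<close>

locale two_connected_vertex_graph = vertex_graph +
  assumes conn_avoiding: "x \<in> V \<Longrightarrow> y \<in> V \<Longrightarrow> x \<noteq> v \<Longrightarrow> y \<noteq> v \<Longrightarrow> conn {v} x y"
    and card_V: "3 \<le> card V"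
begin

lemma conn_empty:
  assumes "x \<in> V" "y \<in> V"
  shows "conn {} x y"
proof -
  \<comment> \<open>a third vertex exists, and \<open>x\<close> and \<open>y\<close> are joined even after its deletion\<close>
  have "card {x, y} < card V" using card_V by (auto simp: card_insert_if)
  then have "\<not> V \<subseteq> {x, y}" using card_mono[of "{x, y}" V] by auto
  then obtain v where "v \<in> V" "v \<noteq> x" "v \<noteq> y" by auto
  then have "conn {v} x y" using assms conn_avoiding by auto
  then show ?thesis
    unfolding conn_def by (rule rtranclp_mono[THEN predicate2D, rotated]) auto
qed

text \<open>
  Keep the path \<open>q\<close> from \<open>y\<close> and look for a path from \<open>z\<close>. A path from \<open>z\<close> that avoids \<open>y\<close> exists because \<open>y\<close>
  is not a cut vertex; follow it until it first meets \<open>p\<close>, \<open>q\<close> or \<open>D\<close>. If it meets \<open>p\<close> or \<open>D\<close> first, it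
  continues to \<open>D\<close> without touching \<open>q\<close>. If it meets \<open>q\<close> first, it takes over the end of \<open>q\<close>, and \<open>y\<close>
  escapes along the edge to \<open>x\<close> and then along \<open>p\<close>.
\<close>

lemma linked_step:
  assumes "linked D x y" "adj x y" "adj y z" "D \<subseteq> V"
  shows "linked D y z"
proof -
  obtain p q where p: "path p" "hd p = x" "last p \<in> D" and q: "path q" "hd q = y" "last q \<in> D"
    and pq: "set p \<inter> set q = {}"
    using assms(1) by (auto simp: linked_def)
  have ne: "p \<noteq> []" "q \<noteq> []" using p q by (auto simp: path_def)
  have "y \<in> set q" using ne q hd_in_set by blast
  then have "y \<notin> set p" "last p \<noteq> y" using pq ne(1) last_in_set by blast+
  moreover have "z \<noteq> y" "z \<in> V" using assms(3) adj_irrefl adj_sym adj_in_V by blast+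
  ultimately have "conn {y} z (last p)"
    using p(3) assms(4) conn_avoiding by blast
  then obtain r where r: "path r" "hd r = z" "last r = last p" "y \<notin> set r"
    using conn_path[of "{y}" z "last p"] \<open>z \<noteq> y\<close> by auto
  have "last r \<in> set r" using r(1) by (simp add: path_def)
  then have "\<exists>v \<in> set r. v \<in> set p \<union> set q \<union> D" using r(3) p(3) by auto
  then obtain r1 v r2 where r_eq: "r = r1 @ v # r2" and v: "v \<in> set p \<union> set q \<union> D"
    and r1: "\<forall>u \<in> set r1. u \<notin> set p \<union> set q \<union> D"
    using split_list_first_prop[of r "\<lambda>v. v \<in> set p \<union> set q \<union> D"] by blast
  have r1v: "path (r1 @ [v])"
    using r(1) r_eq path_appendD1[of "r1 @ [v]" r2] by simp
  have hd_r: "hd (r1 @ v # s) = z" for s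
    using r(2) r_eq by (auto simp: hd_append split: if_splits)
  consider "v \<in> set p" | "v \<in> set q" | "v \<in> D" "v \<notin> set p" "v \<notin> set q" using v by blast
  then show ?thesis
  proof cases
    case 1
    then obtain p1 p2 where p_eq: "p = p1 @ v # p2" by (meson split_list)
    then have "path (v # p2)" using p(1) path_appendD2 by blast
    then have "path (r1 @ v # p2)" using path_join[OF r1v] r1 p_eq by auto
    then show ?thesis
      unfolding linked_def using q pq p(3) p_eq r1 hd_r
      by (intro exI[of _ q] exI[of _ "r1 @ v # p2"]) auto
  next
    case 2
    then obtain q1 q2 where q_eq: "q = q1 @ v # q2" by (meson split_list)
    have "v \<noteq> y" using r(4) r_eq by auto
    then have "q1 \<noteq> []" using q(2) q_eq by auto
    then have "y \<in> set q1" using q(2) q_eq hd_in_set[of q1] by auto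
    then have y: "y \<notin> set (v # q2)" using q(1) q_eq by (auto simp: path_def)
    have "path (v # q2)" using q(1) q_eq path_appendD2 by blast
    then have "path (r1 @ v # q2)" using path_join[OF r1v] r1 q_eq by auto
    moreover have "path (y # p)"
      using p ne(1) \<open>y \<notin> set p\<close> assms(2) adj_sym by (auto simp: path_def successively_Cons)
    moreover have "set (y # p) \<inter> set (r1 @ v # q2) = {}"
    proof -
      have "y \<notin> set r1" using r(4) r_eq by simp
      moreover have "set p \<inter> set r1 = {}" using r1 by blast
      moreover have "set p \<inter> set (v # q2) = {}" using pq q_eq by auto
      ultimately show ?thesis using y by simp blast
    qed
    moreover have "last (y # p) \<in> D" "last (r1 @ v # q2) \<in> D"
      using p(3) q(3) q_eq ne(1) by simp_all
    ultimately show ?thesis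
      unfolding linked_def using hd_r[of q2] by (metis list.sel(1))
  next
    case 3
    then show ?thesis
      unfolding linked_def using q r1v r1 hd_r[of "[]"]
      by (intro exI[of _ q] exI[of _ "r1 @ [v]"]) auto
  qed
qed

text \<open>
  By connectedness the previous step carries the property from one edge to every edge. This replaces
  Menger's theorem for two disjoint paths.
\<close>

lemma linked_all:
  assumes "linked D x y" "adj x y" "D \<subseteq> V" "u \<in> V" "adj u v"
  shows "linked D u v"
proof -
  have "y \<in> V" using assms(2) adj_sym adj_in_V by blast
  then have "conn {} y u" using assms(4) conn_empty by blast
  then have "\<exists>w. linked D w u \<and> adj w u"
    unfolding conn_def
  proof (induction rule: rtranclp_induct)
    case base
    show ?case using assms by blast
  next
    case (step u u')
    then show ?case using linked_step assms(3) by blast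
  qed
  then show ?thesis using assms linked_step by blast
qed

text \<open>
  Two disjoint paths join the two cycles. Together with the longer arcs between their ends on either
  cycle they form a cycle with more than the average of the two lengths.
\<close>

lemma disjoint_cycles_imp_longer:
  assumes c: "cyc c" and d: "cyc d" and disj: "set c \<inter> set d = {}"
  shows "\<exists>e. cyc e \<and> length c + length d < 2 * length e"
proof -
  obtain u u' cs where c_eq: "c = u # u' # cs"
    using c by (cases c; cases "tl c") (auto simp: cyc_def)
  obtain v v' ds where d_eq: "d = v # v' # ds"
    using d by (cases d; cases "tl d") (auto simp: cyc_def)
  have vv: "adj v v'" "v \<noteq> v'" using d d_eq by (auto simp: cyc_def)
  have uu: "adj u u'" using c c_eq by (auto simp: cyc_def)
  have "linked (set d) v v'"
    unfolding linked_def using vv(2) d_eq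
    by (intro exI[of _ "[v]"] exI[of _ "[v']"]) (auto simp: path_def)
  then have "linked (set d) u u'"
    using linked_all vv(1) uu cyc_subset_V[OF d] adj_in_V by blast
  then obtain p q where p: "path p" "hd p = u" "last p \<in> set d" and q: "path q" "hd q = u'" "last q \<in> set d"
    and pq: "set p \<inter> set q = {}"
    by (auto simp: linked_def)
  obtain a m b where m: "path (a # m @ [b])" "a \<in> set c" "b \<in> set d" "set m \<inter> (set c \<union> set d) = {}"
      "set (a # m @ [b]) \<subseteq> set p"
    using path_between_sets[OF p(1) _ p(3) disj] p(2) c_eq by auto
  obtain a' m' b' where m': "path (a' # m' @ [b'])" "a' \<in> set c" "b' \<in> set d" "set m' \<inter> (set c \<union> set d) = {}"
      "set (a' # m' @ [b']) \<subseteq> set q"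
    using path_between_sets[OF q(1) _ q(3) disj] q(2) c_eq by auto
  have "a \<noteq> a'" "b \<noteq> b'" using m(5) m'(5) pq by auto
  then obtain r s where
      r: "path r" "hd r = a" "last r = a'" "set r \<subseteq> set c" "length c + 2 \<le> 2 * length r" and
      s: "path s" "hd s = b" "last s = b'" "set s \<subseteq> set d" "length d + 2 \<le> 2 * length s"
    using cyc_long_arc[OF c m(2) m'(2)] cyc_long_arc[OF d m(3) m'(3)] by blast
  have "cyc (r @ m' @ rev s @ rev m)"
  proof (rule cyc_two_paths[OF r(1-3) s(1-3) m(1) m'(1)])
    show "set m \<inter> set m' = {}" using m(5) m'(5) pq by auto
    show "3 \<le> length r + length s" using r(5) s(5) c_eq d_eq by simp
  qed (use r(4) s(4) m(4) m'(4) disj in blast)+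
  moreover have "length c + length d < 2 * length (r @ m' @ rev s @ rev m)"
    using r(5) s(5) by simp
  ultimately show ?thesis by blast
qed

lemma longest_cycles_meet:
  assumes "longest c" "longest d"
  shows "set c \<inter> set d \<noteq> {}"
proof
  have cd: "cyc c" "cyc d" using assms longest_cyc by blast+
  assume "set c \<inter> set d = {}"
  then obtain e where e: "cyc e" "length c + length d < 2 * length e"
    using disjoint_cycles_imp_longer[OF cd] by blast
  have "length e \<le> length c" "length e \<le> length d"
    using longest_not_longer[OF assms(1) e(1)] longest_not_longer[OF assms(2) e(1)] .
  then show False using e(2) by simp
qed

section \<open>Sets avoided by longest cycles\<close>

text \<open>
  The component \<open>W\<close> is chosen maximal over all longest cycles because that is what makes its
  neighbourhood \<open>N\<close> large: avoiding a small \<open>N\<close> would enlarge the component. A large \<open>N\<close> gives a large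
  set \<open>T\<close> of successors that is scattered once \<open>Z\<close>, the rest of the cycle, is removed, so deleting
  \<open>a\<close> vertices of \<open>Z\<close> costs a cycle about as many vertices of \<open>T\<close> again.
\<close>

lemma avoidable_sets_bound:
  assumes avoid: "\<And>X. X \<subseteq> V \<Longrightarrow> card X \<le> a \<Longrightarrow> \<exists>c. longest c \<and> X \<inter> set c = {}"
  shows "4 * a < card V"
proof (cases "a = 0")
  \<comment> \<open>if \<open>a = 0\<close>, every longest cycle may be spanning and leave no component to choose\<close>
  case True
  then show ?thesis using card_V by simp
next
  case False
  \<comment> \<open>a component is represented by one of its vertices\<close>
  define P where "P = (\<lambda>(c, x). longest c \<and> x \<in> V \<and> x \<notin> set c)"
  define f where "f = (\<lambda>(c, x). card (component (set c) x))"
  have component_V: "component S x \<subseteq> V" if "x \<in> V" for S x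
    using that conn_in_V by (auto simp: component_def)
  obtain v where "v \<in> V" using card_V by fastforce
  then obtain c0 where "longest c0" "v \<notin> set c0"
    using avoid[of "{v}"] False by auto
  then have "P (c0, v)" using \<open>v \<in> V\<close> by (simp add: P_def)
  moreover have "\<forall>y. P y \<longrightarrow> f y < Suc (card V)"
    using component_V finite_V by (auto simp: P_def f_def less_Suc_eq_le intro: card_mono)
  ultimately obtain y where "P y" and y_max: "\<forall>z. P z \<longrightarrow> f z \<le> f y"
    using ex_has_greatest_nat[of P "(c0, v)" f "Suc (card V)"] by blast
  then obtain c x where y: "y = (c, x)" and c: "longest c" and x: "x \<in> V" "x \<notin> set c"
    by (auto simp: P_def)
  define W where "W = component (set c) x"
  define N where "N = nbhd W"
  have max: "card (component (set d) z) \<le> card W" if "longest d" "z \<in> V" "z \<notin> set d" for d z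
    using y_max[rule_format, of "(d, z)"] that y by (simp add: P_def f_def W_def)
  have cyc: "cyc c" "distinct c" "set c \<subseteq> V"
    using longest_cyc[OF c] cyc_subset_V[OF longest_cyc[OF c]] by (auto simp: cyc_def)
  have N_c: "N \<subseteq> set c"
    unfolding N_def W_def using nbhd_component_subset[OF x(2)] .
  have x_W: "x \<in> W" by (simp add: W_def component_def conn_def)
  have W_V: "W \<subseteq> V" unfolding W_def using component_V x(1) .
  have W_c: "W \<inter> set c = {}"
    using conn_notin x(2) by (auto simp: W_def component_def)
  have card_N: "a < card N"
  proof (rule ccontr)
    assume "\<not> a < card N"
    then obtain d where d: "longest d" "N \<inter> set d = {}"
      using avoid[of N] N_c cyc(3) by auto
    show False
    proof (cases "W \<inter> set d = {}")
      case True
      have x_d: "x \<notin> set d" using True x_W by auto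
      have W_sub: "conn (set d) x w" if "w \<in> W" for w
      proof -
        have "conn (set c) x w" using that by (simp add: W_def component_def)
        then have "w \<in> W \<and> conn (set d) x w"
          unfolding conn_def[of "set c"]
        proof (induction rule: rtranclp_induct)
          case base
          show ?case using x_W by (simp add: conn_def)
        next
          case (step u w)
          then have "w \<in> W" using component_closed unfolding W_def by blast
          moreover have "conn (set d) u w" using step \<open>w \<in> W\<close> True by (intro conn_adj) auto
          ultimately show ?case using step conn_trans by blast
        qed
        then show ?thesis ..
      qed
      have "N \<noteq> {}"
      proof
        assume "N = {}"
        have cl: "u \<in> W \<longleftrightarrow> w \<in> W" if "adj u w" for u w
          using that \<open>N = {}\<close> adj_sym unfolding N_def nbhd_def by blast
        obtain z where z: "z \<in> set c" using cyc(1) by (cases c) (auto simp: cyc_def)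
        then have "conn {} x z" using conn_empty x(1) cyc(3) by blast
        then have "z \<in> W" unfolding conn_def
          by (induction rule: rtranclp_induct) (use x_W cl in auto)
        then show False using z W_c by blast
      qed
      then obtain u where u: "u \<in> N" by blast
      then obtain w where w: "w \<in> W" "adj u w" "u \<notin> W" by (auto simp: N_def nbhd_def)
      have "conn (set d) x u"
        using conn_trans[OF W_sub[OF w(1)] conn_adj[of w u]] w u d(2) True adj_sym by blast
      then have "insert u W \<subseteq> component (set d) x"
        using W_sub by (auto simp: component_def)
      then have "card (insert u W) \<le> card (component (set d) x)"
        using component_V[OF x(1)] finite_V finite_subset by (intro card_mono) blast+
      then show False
        using max[OF d(1) x(1) x_d] w(3) W_V finite_V finite_subset by fastforce
    next
      case False
      then obtain w where w: "w \<in> W" "w \<in> set d" by blast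
      have succ: "successively adj d" using longest_cyc[OF d(1)] by (simp add: cyc_def)
      have "u \<in> W" if "u \<in> set d" for u
        using successively_const[OF succ, where P = "\<lambda>u. u \<in> W" and x = u and y = w] that w d(2) adj_sym
        unfolding N_def nbhd_def by blast
      then have "set c \<inter> set d = {}" using W_c by blast
      then show False using longest_cycles_meet[OF c d(1)] by blast
    qed
  qed
  define T where "T = successors c N"
  define Z where "Z = set c - T"
  have "c \<noteq> []" using cyc(1) by (auto simp: cyc_def)
  then have T_c: "T \<subseteq> set c" unfolding T_def by (rule successors_subset)
  have card_T: "card T = card N" unfolding T_def using card_successors[OF cyc(2) N_c] .
  have "N \<subseteq> Z" unfolding Z_def T_def using N_c successors_disjoint[OF c x(2)] unfolding N_def W_def by blast
  then have "card N \<le> card Z" by (intro card_mono) (auto simp: Z_def)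
  then obtain X where X: "X \<subseteq> Z" "card X = a" "finite X"
    using obtain_subset_with_card_n[of a Z] card_N by (metis le_trans less_imp_le)
  have X_V: "X \<subseteq> V" using X cyc(3) by (auto simp: Z_def)
  then obtain e where e: "longest e" "X \<inter> set e = {}"
    using avoid[of X] X(2) by auto
  have e_cyc: "cyc e" "distinct e" "set e \<subseteq> V"
    using longest_cyc[OF e(1)] cyc_subset_V[OF longest_cyc[OF e(1)]] by (auto simp: cyc_def)
  have len_e: "length e = length c"
    using longest_not_longer[OF c e_cyc(1)] longest_not_longer[OF e(1) cyc(1)] by simp
  have "card (set e \<inter> T) \<le> card (set e \<inter> Z) + 1"
  proof (rule card_le_if_separated[OF e_cyc(2)])
    show "T \<inter> Z = {}" by (auto simp: Z_def)
    fix as t bs t' cs assume e_eq: "e = as @ t # bs @ t' # cs" and t: "t \<in> T" "t' \<in> T"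
    show "set bs \<inter> Z \<noteq> {}"
    proof
      assume bs: "set bs \<inter> Z = {}"
      \<comment> \<open>\<open>u\<close> is the first vertex of \<open>T\<close> after \<open>t\<close>, so the vertices in between are off \<open>c\<close>\<close>
      have "\<exists>u \<in> set (bs @ [t']). u \<in> T" using t by auto
      then obtain q u rs where q: "bs @ [t'] = q @ u # rs" "u \<in> T" "\<forall>w \<in> set q. w \<notin> T"
        using split_list_first_prop[of "bs @ [t']" "\<lambda>u. u \<in> T"] by blast
      have "set q \<subseteq> set bs"
        using q(1) by (cases rs rule: rev_cases) auto
      then have q_c: "set q \<inter> set c = {}" using q(3) bs by (auto simp: Z_def)
      have "path e" using e_cyc(1) by (auto simp: cyc_def path_def)
      moreover have "e = as @ ([t] @ q @ [u]) @ rs @ cs"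
        using arg_cong[OF q(1), of "\<lambda>l. as @ [t] @ l @ cs"] e_eq by simp
      ultimately have q_path: "path ([t] @ q @ [u])"
        using path_appendD1 path_appendD2 by (metis append_is_Nil_conv not_Cons_self2)
      then have "t \<noteq> u" by (auto simp: path_def)
      then show False
        using no_path_between_successors[OF c x(2), of t u q] q_path q_c t(1) q(2)
        unfolding T_def N_def W_def by blast
    qed
  qed
  moreover have "length e = card (set e \<inter> T) + card (set e \<inter> Z) + card (set e - set c)"
  proof -
    have "length e = card (set e)" using e_cyc(2) by (simp add: distinct_card)
    also have "set e = (set e \<inter> T) \<union> (set e \<inter> Z) \<union> (set e - set c)"
      using T_c by (auto simp: Z_def)
    also have "card \<dots> = card (set e \<inter> T \<union> set e \<inter> Z) + card (set e - set c)"
      using T_c by (intro card_Un_disjoint) (auto simp: Z_def)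
    also have "card (set e \<inter> T \<union> set e \<inter> Z) = card (set e \<inter> T) + card (set e \<inter> Z)"
      by (intro card_Un_disjoint) (auto simp: Z_def)
    finally show ?thesis .
  qed
  moreover have "card (set e \<inter> Z) + a \<le> card Z"
  proof -
    have "card (set e \<inter> Z) + card X = card ((set e \<inter> Z) \<union> X)"
      using e(2) X(3) by (intro card_Un_disjoint[symmetric]) auto
    also have "\<dots> \<le> card Z" using X(1) by (intro card_mono) (auto simp: Z_def)
    finally show ?thesis using X(2) by simp
  qed
  moreover have "card Z + card N = length c"
  proof -
    have "finite T" using T_c finite_subset by blast
    then have "card Z = card (set c) - card T" unfolding Z_def using T_c by (rule card_Diff_subset)
    moreover have "card T \<le> card (set c)" using T_c by (intro card_mono) auto
    ultimately show ?thesis using card_T distinct_card[OF cyc(2)] by simp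
  qed
  moreover have "card (set e - set c) + length c \<le> card V"
  proof -
    have "card (set e - set c) + card (set c) = card ((set e - set c) \<union> set c)"
      by (intro card_Un_disjoint[symmetric]) auto
    also have "\<dots> \<le> card V" using e_cyc(3) cyc(3) finite_V by (intro card_mono) auto
    finally show ?thesis using distinct_card[OF cyc(2)] by simp
  qed
  ultimately show ?thesis using len_e card_N by linarith
qed

end
section \<open>Closed walks of arcs and cyclic lists of vertices\<close>

context graph
begin

sublocale vertex_graph "verts G" "dominates G"
proof
  show "v \<rightarrow>\<^bsub>G\<^esub> u" if "u \<rightarrow>\<^bsub>G\<^esub> v" for u v
    using that sym_arcs by (simp add: symmetric_def symD)
  show "u \<in> verts G" if "u \<rightarrow>\<^bsub>G\<^esub> v" for u v
    using that by (elim reachableE) (auto intro: tail_in_verts)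
  show "\<not> u \<rightarrow>\<^bsub>G\<^esub> u" for u
    using adj_not_same[of u] by iprover
  show "finite (verts G)" by (rule finite_verts)
qed

lemma cas_successively:
  assumes "cas u p v" "set p \<subseteq> arcs G"
  shows "successively (dominates G) (map (tail G) p) \<and>
    (p \<noteq> [] \<longrightarrow> hd (map (tail G) p) = u \<and> last (map (tail G) p) \<rightarrow>\<^bsub>G\<^esub> v)"
  using assms
proof (induction p arbitrary: u)
  case (Cons a p)
  have "tail G a \<rightarrow>\<^bsub>G\<^esub> head G a" using Cons.prems by (auto intro: in_arcs_imp_in_arcs_ends)
  then show ?case using Cons by (auto simp: successively_Cons)
qed simp

lemma ucycle_imp_cyc:
  assumes "ucycle G p"
  shows "cyc (map (tail G) p)"
proof -
  obtain u where u: "awalk u p u" "distinct (tl (awalk_verts u p))" "p \<noteq> []" "3 \<le> length p"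
    using assms by (auto simp: ucycle_def cycle_def)
  have cas: "cas u p u" "set p \<subseteq> arcs G" using u(1) by (auto simp: awalk_def)
  have "awlast u p = u" using cas(1) by (rule awlast_if_cas)
  then have "head G (last p) = u" using u(3) by (simp add: awalk_verts_conv)
  moreover have hd: "hd (map (tail G) p) = u" using cas_successively[OF cas] u(3) by blast
  ultimately have "distinct (map (tail G) p)"
    using u(2,3) by (cases p) (auto simp: awalk_verts_conv)
  then show ?thesis
    using cas_successively[OF cas] u(3,4) hd by (simp add: cyc_def)
qed

text \<open>
  The vertex \<open>w\<close> closes the walk: a list of arcs has one tail less than its walk has vertices.
\<close>

lemma successively_imp_cas:
  assumes "successively (dominates G) (vs @ [w])"
  shows "\<exists>p. set p \<subseteq> arcs G \<and> map (tail G) p = vs \<and> cas (hd (vs @ [w])) p w"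
  using assms
proof (induction vs)
  case Nil
  have "cas w [] w" by simp
  then show ?case by (intro exI[of _ "[]"]) simp
next
  case (Cons v vs)
  have "successively (dominates G) (vs @ [w])"
    using Cons.prems by (simp add: successively_Cons)
  then obtain p where p: "set p \<subseteq> arcs G" "map (tail G) p = vs" "cas (hd (vs @ [w])) p w"
    using Cons.IH by blast
  have "v \<rightarrow>\<^bsub>G\<^esub> hd (vs @ [w])" using Cons.prems by (simp add: successively_Cons)
  then obtain e where "e \<in> arcs G" "tail G e = v" "head G e = hd (vs @ [w])"
    by (rule reachableE)
  then show ?case using p by (intro exI[of _ "e # p"]) simp
qed

lemma cyc_imp_ucycle:
  assumes "cyc c"
  shows "\<exists>p. ucycle G p \<and> map (tail G) p = c"
proof -
  have c: "3 \<le> length c" "distinct c" "c \<noteq> []" using assms by (auto simp: cyc_def)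
  have "successively (dominates G) (c @ [hd c])"
    using assms by (auto simp: cyc_def successively_append_iff)
  then obtain p where p: "set p \<subseteq> arcs G" "map (tail G) p = c" "cas (hd c) p (hd c)"
    using successively_imp_cas[of c "hd c"] c(3) by auto
  have len: "length p = length c" using arg_cong[OF p(2), of length] by simp
  have ne: "p \<noteq> []" using p(2) c(3) by auto
  have "hd c \<in> verts G" using cyc_subset_V[OF assms] c(3) by auto
  then have "awalk (hd c) p (hd c)" using p by (simp add: awalk_def)
  moreover have "head G (last p) = hd c"
    using awlast_if_cas[OF p(3)] ne by (simp add: awalk_verts_conv)
  then have "awalk_verts (hd c) p = c @ [hd c]"
    using ne p(2) by (simp add: awalk_verts_conv)
  then have "distinct (tl (awalk_verts (hd c) p))"
    using c(2,3) by (cases c) auto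
  ultimately show ?thesis
    using p(2) ne len c(1) unfolding ucycle_def cycle_def by auto
qed

lemma longest_cycle_imp_longest:
  assumes "longest_cycle G p"
  shows "longest (map (tail G) p)"
  unfolding longest_def
proof (intro conjI allI impI)
  show "cyc (map (tail G) p)"
    using assms ucycle_imp_cyc by (simp add: longest_cycle_def)
  fix d assume "cyc d"
  then obtain q where "ucycle G q" "map (tail G) q = d"
    using cyc_imp_ucycle by blast
  then show "length d \<le> length (map (tail G) p)"
    using assms by (auto simp: longest_cycle_def)
qed

lemma connected_imp_conn:
  assumes "connected H" "x \<in> verts H" "y \<in> verts H"
    and "\<And>e. e \<in> arcs H \<Longrightarrow> tail H e \<rightarrow>\<^bsub>G\<^esub> head H e \<and> tail H e \<notin> S \<and> head H e \<notin> S"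
  shows "conn S x y"
proof -
  have "(x, y) \<in> rtrancl_on (verts H) (parcs (mk_symmetric H))"
    using assms(1-3) by (auto simp: connected_def strongly_connected_def reachable_def)
  then show ?thesis
  proof (induction rule: rtrancl_on_induct)
    case base
    show ?case by (simp add: conn_def)
  next
    case (step y z)
    then have "conn S y z"
      using assms(4) adj_sym by (auto simp: parcs_mk_symmetric intro!: conn_adj)
    then show ?case using step.IH conn_trans by blast
  qed
qed

lemma two_connected_vertex_graph:
  assumes "two_connected G"
  shows "two_connected_vertex_graph (verts G) (dominates G)"
proof unfold_locales
  show "3 \<le> card (verts G)" using assms by (simp add: two_connected_def)
  fix x y v assume xy: "x \<in> verts G" "y \<in> verts G" "x \<noteq> v" "y \<noteq> v"
  show "conn {v} x y"
  proof (cases "v \<in> verts G")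
    case True
    then have "connected (del_vert v)" using assms by (simp add: two_connected_def)
    then show ?thesis
      by (rule connected_imp_conn)
         (use xy in \<open>auto simp: del_vert_simps intro: in_arcs_imp_in_arcs_ends\<close>)
  next
    case False
    have "connected G" using assms by (simp add: two_connected_def)
    then show ?thesis
      by (rule connected_imp_conn)
         (use xy False in \<open>auto intro: in_arcs_imp_in_arcs_ends dest: tail_in_verts head_in_verts\<close>)
  qed
qed

text \<open>
  No set smaller than \<open>lct G\<close> is a transversal, so every set of at most \<open>lct G - 1\<close> vertices is avoided by
  some longest cycle.
\<close>

lemma lct_le_quarter:
  assumes "two_connected G"
  shows "4 * lct G < card (verts G) + 4"
proof (cases "lct G")
  case (Suc a)
  interpret two_connected_vertex_graph "verts G" "dominates G"
    using two_connected_vertex_graph assms .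
  have "4 * a < card (verts G)"
  proof (rule avoidable_sets_bound)
    fix X assume X: "X \<subseteq> verts G" "card X \<le> a"
    then have "\<not> longest_cycle_transversal G X"
      using lct_le[of G X] Suc by auto
    then obtain p where "longest_cycle G p" "X \<inter> cycle_verts G p = {}"
      using X(1) by (auto simp: longest_cycle_transversal_def)
    then show "\<exists>c. longest c \<and> X \<inter> set c = {}"
      using longest_cycle_imp_longest by (intro exI[of _ "map (tail G) p"]) (simp add: cycle_verts_def)
  qed
  then show ?thesis using Suc by simp
qed simp

end

theorem theorem3:
  fixes G :: "('a, 'b) pre_digraph" and n :: nat
  assumes "graph G" and "two_connected G" and "card (verts G) = n"
  shows "int (lct G) \<le> \<lceil>real n / 3 - real n powr (2 / 3) / 36\<rceil>"
proof -
  have "4 * lct G < n + 4"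
    using graph.lct_le_quarter[OF assms(1,2)] assms(3) by simp
  moreover have "3 \<le> n" using assms(2,3) by (simp add: two_connected_def)
  then have "real n powr (2 / 3) \<le> real n powr 1"
    by (intro powr_mono) auto
  ultimately have "real (lct G) - 1 < real n / 3 - real n powr (2 / 3) / 36"
    by simp
  then show ?thesis by (simp add: le_ceiling_iff)
qed

end
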